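(* Let $n\ge 2$ and let $a,b,C,\alpha,\beta,\gamma\in\mathbb{C}$ be such that $ab\neq 0$, $\Delta\neq 0$, $\alpha^2\neq 0$ and $\alpha^2\neq ab$, where $\Delta=abC+2\alpha\beta\gamma-a\gamma^2-b\beta^2-C\alpha^2$. Then the system of partial differential equations $$\begin{cases} a f_1^2+2\alpha f_1\dfrac{\partial f_2}{\partial z_1}+b\left(\dfrac{\partial f_2}{\partial z_1}\right)^2+2\beta f_1+2\gamma\dfrac{\partial f_2}{\partial z_1}+C=0,\\[2mm] a f_2^2+2\alpha f_2\dfrac{\partial f_1}{\partial z_1}+b\left(\dfrac{\partial f_1}{\partial z_1}\right)^2+2\beta f_2+2\gamma\dfrac{\partial f_1}{\partial z_1}+C=0\end{cases}$$ (for all $z=(z_1,\ldots,z_n)\in\mathbb{C}^n$, with $f_j=f_j(z)$) has no pair $(f_1,f_2)$ of finite order transcendental entire solutions in $\mathbb{C}^n$.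
   Context: Order of a meromorphic function $f$ on $\mathbb{C}^n$: $\rho(f)=\limsup_{r\to\infty}\frac{\log^+T(r,f)}{\log r}$, where $T(r,f)$ is the Nevanlinna characteristic; finite order means $\rho(f)<\infty$. An entire function on $\mathbb{C}^n$ is transcendental if it is not a polynomial. A pair of finite order transcendental entire solutions is a solution $(f_1,f_2)$ in which both $f_1$ and $f_2$ are transcendental entire functions of finite order. *)

theory Defs
  imports "HOL-Analysis.Analysis"
begin

text \<open>Holomorphic on all of \<open>\<complex>\<^sup>n\<close>: Frechet differentiable everywhere with a \<open>\<complex>\<close>-linear differential.\<close>

definition entire :: "(complex ^ 'n::finite \<Rightarrow> complex) \<Rightarrow> bool" where
  "entire f \<longleftrightarrow>
     (\<forall>z. \<exists>D. (f has_derivative D) (at z) \<and> (\<forall>c v. D (c *s v) = c * D v))"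

definition partial_deriv ::
    "'n::finite \<Rightarrow> (complex ^ 'n \<Rightarrow> complex) \<Rightarrow> complex ^ 'n \<Rightarrow> complex" where
  "partial_deriv i f z = deriv (\<lambda>t. f (z + axis i t)) 0"

definition polynomial_fun :: "(complex ^ 'n::finite \<Rightarrow> complex) \<Rightarrow> bool" where
  "polynomial_fun f \<longleftrightarrow>
     (\<exists>(S :: ('n \<Rightarrow> nat) set) c. finite S \<and>
        (\<forall>z. f z = (\<Sum>m\<in>S. c m * (\<Prod>i\<in>UNIV. (z $ i) ^ m i))))"

definition transcendental_entire :: "(complex ^ 'n::finite \<Rightarrow> complex) \<Rightarrow> bool" where
  "transcendental_entire f \<longleftrightarrow> entire f \<and> \<not> polynomial_fun f"

text \<open>Only applied to nonnegative arguments; \<open>ln 0 = 0\<close> gives the usual value 0 at 0.\<close>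

definition log_plus :: "real \<Rightarrow> real" where
  "log_plus x = max 0 (ln x)"

text \<open>
  The rotation-invariant probability measure on the unit sphere, obtained as the image of the
  uniform distribution on the unit ball under radial projection. On \<open>\<complex>\<^sup>n\<close> it is the measure
  given by the form \<open>d\<^sup>c log |z|\<^sup>2 \<and> (dd\<^sup>c log |z|\<^sup>2)\<^bsup>n-1\<^esup>\<close>, normalized to total mass 1. The
  value of \<open>sgn\<close> at the origin is irrelevant, the origin being a null set.
\<close>

definition unit_sphere_measure :: "'a::euclidean_space measure" where
  "unit_sphere_measure = distr (uniform_measure lborel (ball 0 1)) borel sgn"

text \<open>
  The Nevanlinna characteristic is \<open>T(r,f) = m(r,f) + N(r,f)\<close>. An entire function has no poles,
  so the counting function \<open>N(r,f)\<close> vanishes and \<open>T(r,f)\<close> is the proximity function, the mean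
  of \<open>log\<^sup>+ |f|\<close> over the sphere of radius \<open>r\<close>. The two definitions below are meant for entire
  \<open>f\<close> only.
\<close>

definition nevanlinna_T :: "real \<Rightarrow> (complex ^ 'n::finite \<Rightarrow> complex) \<Rightarrow> real" where
  "nevanlinna_T r f = (\<integral>w. log_plus (norm (f (r *\<^sub>R w))) \<partial>unit_sphere_measure)"

definition growth_order :: "(complex ^ 'n::finite \<Rightarrow> complex) \<Rightarrow> ereal" where
  "growth_order f = Limsup at_top (\<lambda>r. ereal (log_plus (nevanlinna_T r f) / ln r))"

definition finite_order :: "(complex ^ 'n::finite \<Rightarrow> complex) \<Rightarrow> bool" where
  "finite_order f \<longleftrightarrow> growth_order f < \<infinity>"

end

theory Submission
  imports Defs "HOL-Complex_Analysis.Conformal_Mappings"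
begin

text \<open>Only the restrictions of \<open>f1\<close>, \<open>f2\<close> to complex lines in direction \<open>z\<^sub>1\<close> matter. There the
  quadratic equation is that of a hyperbola, and the two entire linear factors multiply to a nonzero
  constant, so they are \<open>k exp (\<plusminus> p)\<close> and \<open>k exp (\<plusminus> q)\<close> for the two equations. Comparing the two
  expressions for each derivative gives
  \<open>p' (t\<^sub>2 exp p + t\<^sub>1 exp (- p)) = \<eta> + exp q - exp (- q)\<close> and the same with \<open>p\<close>, \<open>q\<close> exchanged.
  At a point of a circle where one of \<open>\<plusminus> Re p\<close>, \<open>\<plusminus> Re q\<close> attains the largest value of all four, this
  bounds the corresponding derivative, so \<open>Re p\<close> and \<open>Re q\<close> grow at most linearly and \<open>p\<close>, \<open>q\<close> are
  affine. For affine \<open>p\<close>, \<open>q\<close> comparing coefficients leaves only constants. Hence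
  \<open>\<partial>f1/\<partial>z\<^sub>1 = 0\<close>, and \<open>f2\<close> is a continuous root of a fixed quadratic polynomial.\<close>

section \<open>Growth of entire functions and of their real parts\<close>

text \<open>The line \<open>Re = M\<close> is the perpendicular bisector of 0 and
  \<open>2 * M\<close>, and \<open>h\<close> lies on the side of 0. Hence
  \<open>h / (2 * M - h)\<close> has norm below 1.\<close>

lemma norm_less_norm_reflect:
  fixes h :: complex
  assumes "Re h < M" "0 < M"
  shows "norm h < norm (2 * of_real M - h)"
proof -
  have "(norm h)\<^sup>2 < (norm (2 * of_real M - h))\<^sup>2"
    unfolding cmod_power2 using mult_strict_left_mono[OF assms]
    by (simp add: power2_eq_square algebra_simps)
  then show ?thesis
    by (rule power_less_imp_less_base) simp
qed

text \<open>The Borel-Caratheodory argument: the Schwarz lemma turns the one-sided bound on the real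
  part into a linear bound on the norm, and Liouville's theorem for polynomial growth then leaves
  degree at most 1.\<close>

lemma entire_affine_if_Re_le:
  assumes holf: "f holomorphic_on UNIV" and bnd: "\<And>z. Re (f z) \<le> K * norm z + c"
  obtains A B where "\<And>z. f z = A + B * z"
proof -
  define D where "D = 4 * \<bar>K\<bar> + 2 * \<bar>c\<bar> + 3 * norm (f 0) + 2"
  have "norm (f z) \<le> D * norm z ^ 1" if z: "1 \<le> norm z" for z
  proof -
    \<comment> \<open>The factor 2 puts \<open>z / R\<close> at radius 1/2, so the Schwarz lemma
      gives \<open>2 * norm h \<le> norm (2 * M - h)\<close> there and thus
      \<open>norm h \<le> 2 * M\<close>. The summand 1 in \<open>M\<close> makes
      \<open>Re h < M\<close> strict.\<close>
    define R where "R = 2 * norm z"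
    define M where "M = \<bar>K\<bar> * R + \<bar>c\<bar> + norm (f 0) + 1"
    define h where "h = (\<lambda>w. f (of_real R * w) - f 0)"
    have R: "R > 0" using z by (auto simp: R_def)
    have M: "M > 0" using R by (simp add: M_def add_nonneg_pos)
    have Re_h: "Re (h w) < M" if "norm w < 1" for w
    proof -
      have "K * norm (of_real R * w) \<le> \<bar>K\<bar> * R"
        using R that by (intro mult_mono) (auto simp: norm_mult)
      moreover have "- Re (f 0) \<le> norm (f 0)"
        by (metis abs_Re_le_cmod abs_le_D2)
      ultimately show ?thesis
        using bnd[of "of_real R * w"] abs_ge_self[of c] unfolding h_def M_def minus_complex.sel by linarith
    qed
    have holh: "h holomorphic_on ball 0 1"
      unfolding h_def
      by (intro holomorphic_intros holomorphic_on_compose_gen[OF _ holf, unfolded o_def]) auto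
    have less: "norm (h w) < norm (2 * of_real M - h w)" if "norm w < 1" for w
      by (rule norm_less_norm_reflect[OF Re_h[OF that] M])
    have norm_w: "norm (z / of_real R) = 1 / 2"
      using z by (auto simp: R_def norm_divide norm_mult)
    have hz: "h (z / of_real R) = f z - f 0"
      using R by (simp add: h_def)
    have "norm (h (z / of_real R) / (2 * of_real M - h (z / of_real R))) \<le> norm (z / of_real R)"
    proof (rule Schwarz_Lemma(1)[of "\<lambda>w. h w / (2 * of_real M - h w)"])
      show "(\<lambda>w. h w / (2 * of_real M - h w)) holomorphic_on ball 0 1"
        using less by (intro holomorphic_intros holh) (metis dist_0_norm less_irrefl mem_ball norm_ge_zero norm_zero not_le)
      show "norm (h w / (2 * of_real M - h w)) < 1" if "norm w < 1" for w
        using less[OF that] by (simp add: norm_divide divide_less_eq)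
      show "norm (z / of_real R) < 1" using norm_w by simp
    qed (simp add: h_def)
    then have "norm (f z - f 0) / norm (2 * of_real M - (f z - f 0)) \<le> 1 / 2"
      by (simp only: norm_divide[of "f z - f 0"] hz norm_w)
    moreover have "norm (2 * of_real M - (f z - f 0)) > 0"
      using less[of "z / of_real R"] norm_w hz by (smt (verit) norm_ge_zero half_bounded_equal)
    ultimately have "2 * norm (f z - f 0) \<le> norm (2 * of_real M - (f z - f 0))"
      by (simp add: field_simps)
    also have "\<dots> \<le> norm (2 * of_real M :: complex) + norm (f z - f 0)"
      by (rule norm_triangle_ineq4)
    finally have "norm (f z - f 0) \<le> 2 * M"
      using M by (simp add: norm_mult)
    then have "norm (f z) \<le> 4 * \<bar>K\<bar> * norm z + (2 * \<bar>c\<bar> + 3 * norm (f 0) + 2) * 1"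
      using norm_triangle_ineq2[of "f z" "f 0"] by (simp add: M_def R_def)
    also have "\<dots> \<le> 4 * \<bar>K\<bar> * norm z + (2 * \<bar>c\<bar> + 3 * norm (f 0) + 2) * norm z"
      using z by (intro add_left_mono mult_left_mono) auto
    finally show ?thesis by (simp add: D_def algebra_simps)
  qed
  note poly = Liouville_polynomial[OF holf this]
  have "f z = f 0 + deriv f 0 * z" for z
    using poly[where \<xi> = z] by simp
  then show thesis by (rule that)
qed

text \<open>At a maximum of \<open>Re (h i z) - (K + 1) * norm z\<close> over \<open>i\<close> and a closed disc, the radial
  derivative of \<open>Re (h i)\<close> would be at least \<open>K + 1\<close>.\<close>

lemma Re_le_linear_if_deriv_bounded_at_max:
  fixes h h' :: "'i \<Rightarrow> complex \<Rightarrow> complex"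
  assumes fin: "finite I" and K: "0 \<le> K"
    and der: "\<And>i z. i \<in> I \<Longrightarrow> (h i has_field_derivative h' i z) (at z)"
    and bnd: "\<And>i z. i \<in> I \<Longrightarrow> S \<le> Re (h i z) \<Longrightarrow> (\<forall>j\<in>I. Re (h j z) \<le> Re (h i z))
                \<Longrightarrow> norm (h' i z) \<le> K"
  obtains c where "\<And>i z. i \<in> I \<Longrightarrow> Re (h i z) \<le> (K + 1) * norm z + c"
proof (cases "I = {}")
  case False
  \<comment> \<open>A maximum above this \<open>c\<close> is not attained at 0, and the real part
    there is at least \<open>S\<close>, as needed for \<open>bnd\<close>.\<close>
  define c where "c = max S (Max ((\<lambda>i. Re (h i 0)) ` I))"
  define \<phi> where "\<phi> = (\<lambda>i z. Re (h i z) - (K + 1) * norm z)"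
  have c0: "Re (h i 0) \<le> c" if "i \<in> I" for i
    using that fin by (auto simp: c_def le_max_iff_disj)
  have "\<phi> i w \<le> c" if iI: "i \<in> I" for i w
  proof -
    have "\<exists>z\<in>cball 0 (norm w). \<forall>y\<in>cball 0 (norm w). \<phi> j y \<le> \<phi> j z" if "j \<in> I" for j
    proof (rule continuous_attains_sup)
      have "continuous_on (cball 0 (norm w)) (h j)"
        using der[OF that] by (intro continuous_at_imp_continuous_on ballI DERIV_isCont)
      then show "continuous_on (cball 0 (norm w)) (\<phi> j)"
        unfolding \<phi>_def by (intro continuous_intros)
    qed auto
    then obtain m where m: "\<And>j. j \<in> I \<Longrightarrow> m j \<in> cball 0 (norm w)"
      and m_max: "\<And>j y. j \<in> I \<Longrightarrow> y \<in> cball 0 (norm w) \<Longrightarrow> \<phi> j y \<le> \<phi> j (m j)"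
      by metis
    have "Max ((\<lambda>j. \<phi> j (m j)) ` I) \<in> (\<lambda>j. \<phi> j (m j)) ` I"
      using fin False by (intro Max_in) auto
    then obtain k where k: "k \<in> I" and "\<phi> k (m k) = Max ((\<lambda>j. \<phi> j (m j)) ` I)"
      by (metis imageE)
    then have "\<And>j. j \<in> I \<Longrightarrow> \<phi> j (m j) \<le> \<phi> k (m k)"
      using fin by simp
    then have max: "\<phi> j y \<le> \<phi> k (m k)" if "j \<in> I" "y \<in> cball 0 (norm w)" for j y
      using m_max that order_trans by blast
    define z where "z = m k"
    have z: "norm z \<le> norm w" using m[OF k] by (simp add: z_def)
    have "\<phi> k z \<le> c"
    proof (rule ccontr)
      assume "\<not> ?thesis"
      then have gt: "\<phi> k z > c" by simp
      have "z \<noteq> 0" using gt c0[OF k] by (auto simp: \<phi>_def)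
      have "S \<le> c" by (simp add: c_def)
      moreover have "\<phi> k z \<le> Re (h k z)" using K by (simp add: \<phi>_def)
      ultimately have "S \<le> Re (h k z)" using gt by linarith
      \<comment> \<open>At one and the same point all \<open>\<phi> j\<close> subtract the same
        term, so maximality of \<open>\<phi> k z\<close> carries over to the real parts.\<close>
      moreover have "Re (h j z) \<le> Re (h k z)" if "j \<in> I" for j
        using max[OF that, of z] z by (simp add: \<phi>_def z_def)
      ultimately have h'K: "norm (h' k z) \<le> K" using bnd[OF k] by blast
      \<comment> \<open>This is \<open>\<phi> k\<close> along the ray through \<open>z\<close>, with
        \<open>z\<close> at \<open>s = 1\<close>. Its derivative \<open>l\<close> there is negative,
        so moving slightly inwards, which stays in the disc, increases
        \<open>\<phi> k\<close>.\<close>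
      define g where "g = (\<lambda>s. Re (h k (of_real s * z)) - (K + 1) * (s * norm z))"
      define l where "l = Re (z * h' k z) - (K + 1) * norm z"
      have "((\<lambda>s. of_real s * z) has_vector_derivative z) (at 1)"
        unfolding has_vector_derivative_def scaleR_conv_of_real[symmetric]
        by (auto intro!: derivative_eq_intros)
      then have "((\<lambda>s. h k (of_real s * z)) has_vector_derivative (z * h' k z)) (at 1)"
        using field_vector_diff_chain_at[of "\<lambda>s. of_real s * z" z 1 "h k" "h' k z"] der[OF k, of z]
        by (simp add: o_def)
      then have "((\<lambda>s. Re (h k (of_real s * z))) has_real_derivative Re (z * h' k z)) (at 1)"
        by (simp add: has_real_derivative_iff_has_vector_derivative has_vector_derivative_complex_iff)
      moreover have "((\<lambda>s. (K + 1) * (s * norm z)) has_real_derivative (K + 1) * norm z) (at 1)"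
        by (auto intro!: derivative_eq_intros)
      ultimately have "(g has_real_derivative l) (at 1)"
        unfolding l_def g_def by (rule DERIV_diff)
      moreover have "l < 0"
      proof -
        have "Re (z * h' k z) \<le> norm (h' k z) * norm z"
          by (metis complex_Re_le_cmod mult.commute norm_mult)
        also have "\<dots> \<le> K * norm z" using h'K by (intro mult_right_mono) auto
        also have "\<dots> < (K + 1) * norm z" using \<open>z \<noteq> 0\<close> by (simp add: distrib_right)
        finally show ?thesis by (simp add: l_def)
      qed
      ultimately obtain d where d: "d > 0" "\<forall>e>0. e < d \<longrightarrow> g 1 < g (1 - e)"
        using DERIV_neg_dec_left by blast
      \<comment> \<open>The cap at 1 keeps \<open>1 - e\<close> nonnegative, so that it is the
        factor by which the norm scales.\<close>
      define e where "e = min (d / 2) 1"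
      have e: "0 < e" "e < d" "e \<le> 1" using d(1) by (auto simp: e_def)
      have ne: "norm (of_real (1 - e) * z) = (1 - e) * norm z"
        using e by (simp only: norm_mult norm_of_real)
      have "g 1 = \<phi> k z" by (simp add: g_def \<phi>_def)
      moreover have "g (1 - e) = \<phi> k (of_real (1 - e) * z)"
        unfolding g_def \<phi>_def ne ..
      ultimately have "\<phi> k z < \<phi> k (of_real (1 - e) * z)"
        using d(2) e(1,2) by metis
      moreover have "(1 - e) * norm z \<le> norm w"
        using e z mult_right_mono[of "1 - e" 1 "norm z"] by simp
      ultimately show False
        using max[OF k, of "of_real (1 - e) * z"] ne unfolding z_def[symmetric] by simp
    qed
    moreover have "\<phi> i w \<le> \<phi> k z" using max[OF iI, of w] by (simp add: z_def)
    ultimately show ?thesis by linarith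
  qed
  then show thesis
    by (intro that[of c]) (simp add: \<phi>_def algebra_simps)
qed (use that in auto)

section \<open>Exponential systems in one complex variable\<close>

text \<open>For large \<open>Re P\<close> the term \<open>t * exp P\<close> dominates the factor of
  \<open>w\<close>, while \<open>\<bar>Re Q\<bar> \<le> Re P\<close> bounds the right-hand side by a
  multiple of the same \<open>exp (Re P)\<close>. The bounds \<open>K\<close> and \<open>S\<close>
  are uniform in \<open>w\<close>, \<open>P\<close> and \<open>Q\<close>.\<close>

lemma exp_quotient_bounded:
  fixes t t' \<eta> :: complex
  assumes "t \<noteq> 0"
  obtains K S where "0 \<le> K"
    "\<And>w P Q. w * (t * exp P + t' * exp (- P)) = \<eta> + exp Q - exp (- Q) \<Longrightarrow>
       S \<le> Re P \<Longrightarrow> \<bar>Re Q\<bar> \<le> Re P \<Longrightarrow> norm w \<le> K"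
proof -
  \<comment> \<open>From \<open>S \<le> Re P \<le> exp (Re P)\<close> it follows that the second
    term is at most half of the first. The value of \<open>K\<close> then results from
    \<open>norm w * norm t / 2 \<le> norm \<eta> + 2\<close>.\<close>
  define S where "S = 2 * norm t' / norm t"
  define K where "K = 2 * (norm \<eta> + 2) / norm t"
  have t: "norm t > 0" using assms by simp
  have "norm w \<le> K"
    if eq: "w * (t * exp P + t' * exp (- P)) = \<eta> + exp Q - exp (- Q)"
      and S: "S \<le> Re P" and Q: "\<bar>Re Q\<bar> \<le> Re P" for w P Q
  proof -
    define E where "E = exp (Re P)"
    have E: "1 \<le> E" "Re P \<le> E"
      using Q exp_ge_add_one_self[of "Re P"] unfolding E_def by linarith+
    have "2 * norm t' / norm t \<le> E"
      using S E(2) unfolding S_def by linarith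
    then have "norm t' \<le> norm t * E / 2"
      using t by (simp add: pos_divide_le_eq mult.commute)
    moreover have "norm (t' * exp (- P)) \<le> norm t' * 1"
      using Q unfolding norm_mult by (intro mult_left_mono) auto
    moreover have "norm (t * exp P) = norm t * E"
      by (simp add: norm_mult E_def)
    ultimately have "norm t * E / 2 \<le> norm (t * exp P + t' * exp (- P))"
      using norm_diff_ineq[of "t * exp P" "t' * exp (- P)"] by linarith
    then have "norm w * (norm t * E / 2) \<le> norm (\<eta> + exp Q - exp (- Q))"
      unfolding eq[symmetric] norm_mult by (intro mult_left_mono) auto
    also have "\<dots> \<le> norm \<eta> + norm (exp Q) + norm (exp (- Q))"
      by norm
    also have "norm (exp Q) \<le> E" using Q by (simp add: E_def)
    also have "norm (exp (- Q)) \<le> E" using Q by (simp add: E_def)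
    also have "norm \<eta> + E + E \<le> (norm \<eta> + 2) * E"
      using E(1) mult_left_mono[of 1 E "norm \<eta>"] by (simp add: algebra_simps)
    finally have "(norm w * norm t / 2) * E \<le> (norm \<eta> + 2) * E"
      by (simp add: mult_ac)
    then have "norm w * norm t / 2 \<le> norm \<eta> + 2"
      by (rule mult_right_le_imp_le) (use E(1) in simp)
    then show ?thesis using t by (simp add: K_def field_simps)
  qed
  moreover have "0 \<le> K" by (simp add: K_def)
  ultimately show thesis using that by blast
qed

text \<open>The derivative is written in the shape of the assumption, with new coefficients and
  constant 0, so that the rule can be applied to its own result.\<close>

lemma exp_combination_deriv:
  fixes A B A' B' :: complex
  assumes eq: "\<And>z. c\<^sub>1 * exp (A + B * z) + c\<^sub>2 * exp (- (A + B * z))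
              + d\<^sub>1 * exp (A' + B' * z) + d\<^sub>2 * exp (- (A' + B' * z)) = k"
  shows "(B * c\<^sub>1) * exp (A + B * z) + (- B * c\<^sub>2) * exp (- (A + B * z))
              + (B' * d\<^sub>1) * exp (A' + B' * z) + (- B' * d\<^sub>2) * exp (- (A' + B' * z)) = 0"
    (is "?D = _")
proof -
  have "((\<lambda>z. c\<^sub>1 * exp (A + B * z) + c\<^sub>2 * exp (- (A + B * z))
     + d\<^sub>1 * exp (A' + B' * z) + d\<^sub>2 * exp (- (A' + B' * z))) has_field_derivative ?D) (at z)"
    by (auto intro!: derivative_eq_intros simp: algebra_simps)
  then have "((\<lambda>z. k) has_field_derivative ?D) (at z)"
    unfolding eq .
  then show ?thesis using DERIV_unique DERIV_const by blast
qed

text \<open>Differentiation removes \<open>\<eta>\<close>, and the derivatives at 0 are algebraic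
  relations between \<open>exp A\<close> and \<open>exp A'\<close>. They force
  \<open>B'\<^sup>2 = B\<^sup>2\<close> unless \<open>B = 0\<close>, and each choice of sign is
  contradictory.\<close>

lemma affine_exp_system_trivial:
  fixes A B A' B' t\<^sub>1 t\<^sub>2 \<eta> :: complex
  assumes eq1: "\<And>z. B * (t\<^sub>2 * exp (A + B * z) + t\<^sub>1 * exp (- (A + B * z)))
                  = \<eta> + exp (A' + B' * z) - exp (- (A' + B' * z))"
    and eq2: "\<And>z. B' * (t\<^sub>2 * exp (A' + B' * z) + t\<^sub>1 * exp (- (A' + B' * z)))
                  = \<eta> + exp (A + B * z) - exp (- (A + B * z))"
    and t: "t\<^sub>1 \<noteq> 0" "t\<^sub>2 \<noteq> 0" "t\<^sub>1 + t\<^sub>2 \<noteq> 0"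
  shows "B = 0"
proof (rule ccontr)
  assume B: "B \<noteq> 0"
  define x y where "x = exp A" and "y = exp A'"
  have nz: "x \<noteq> 0" "y \<noteq> 0" by (simp_all add: x_def y_def)
  note at_0 = x_def[symmetric] y_def[symmetric] exp_minus[of A] exp_minus[of A'] mult_zero_right add_0_right
  have z0: "\<And>z. (B * t\<^sub>2) * exp (A + B * z) + (B * t\<^sub>1) * exp (- (A + B * z))
       + (- 1) * exp (A' + B' * z) + 1 * exp (- (A' + B' * z)) = \<eta>"
    using eq1 by (simp add: algebra_simps)
  note z1 = exp_combination_deriv[OF z0] note z2 = exp_combination_deriv[OF z1]
  note z3 = exp_combination_deriv[OF z2] note z4 = exp_combination_deriv[OF z3]
  have w0: "\<And>z. (B' * t\<^sub>2) * exp (A' + B' * z) + (B' * t\<^sub>1) * exp (- (A' + B' * z))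
       + (- 1) * exp (A + B * z) + 1 * exp (- (A + B * z)) = \<eta>"
    using eq2 by (simp add: algebra_simps)
  note w1 = exp_combination_deriv[OF w0] note w2 = exp_combination_deriv[OF w1]
  have e1: "B\<^sup>2 * (t\<^sub>2 * x - t\<^sub>1 / x) = B' * (y + 1 / y)"
    using z1[of 0] unfolding at_0 by (simp add: algebra_simps power2_eq_square divide_inverse)
  have e2: "B ^ 3 * (t\<^sub>2 * x + t\<^sub>1 / x) = B'\<^sup>2 * (y - 1 / y)"
    using z2[of 0] unfolding at_0 by (simp add: algebra_simps power2_eq_square power3_eq_cube divide_inverse)
  have e3: "B ^ 4 * (t\<^sub>2 * x - t\<^sub>1 / x) = B' ^ 3 * (y + 1 / y)"
    using z3[of 0] unfolding at_0 by (simp add: algebra_simps power4_eq_xxxx power3_eq_cube divide_inverse)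
  have e4: "B ^ 5 * (t\<^sub>2 * x + t\<^sub>1 / x) = B' ^ 4 * (y - 1 / y)"
    using z4[of 0] unfolding at_0 by (simp add: algebra_simps power4_eq_xxxx eval_nat_numeral divide_inverse)
  have f1: "B'\<^sup>2 * (t\<^sub>2 * y - t\<^sub>1 / y) = B * (x + 1 / x)"
    using w1[of 0] unfolding at_0 by (simp add: algebra_simps power2_eq_square divide_inverse)
  have f2: "B' ^ 3 * (t\<^sub>2 * y + t\<^sub>1 / y) = B\<^sup>2 * (x - 1 / x)"
    using w2[of 0] unfolding at_0 by (simp add: algebra_simps power2_eq_square power3_eq_cube divide_inverse)
  have sum_nz: "\<not> (s * u + r / u = 0 \<and> s * u - r / u = 0)" if "s \<noteq> 0" "u \<noteq> 0" for s u r :: complex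
  proof
    assume "s * u + r / u = 0 \<and> s * u - r / u = 0"
    then have "2 * (s * u) = 0" by algebra
    then show False using that by simp
  qed
  have B': "B' \<noteq> 0"
  proof
    assume "B' = 0"
    then have "t\<^sub>2 * x + t\<^sub>1 / x = 0 \<and> t\<^sub>2 * x - t\<^sub>1 / x = 0"
      using e1 e2 B by simp
    then show False using sum_nz t nz by blast
  qed
  \<comment> \<open>Two differentiations multiply the \<open>x\<close> side by
    \<open>B\<^sup>2\<close> and the \<open>y\<close> side by \<open>B'\<^sup>2\<close>. If these
    differ, then comparing orders 1 and 3, and orders 2 and 4, makes both \<open>y + 1 / y\<close>
    and \<open>y - 1 / y\<close> vanish.\<close>
  have "B'\<^sup>2 = B\<^sup>2"
  proof (rule ccontr)
    assume ne: "B'\<^sup>2 \<noteq> B\<^sup>2"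
    have "(B'\<^sup>2 - B\<^sup>2) * (B' * (y + 1 / y)) = 0"
      using e1 e3 by algebra
    moreover have "(B'\<^sup>2 - B\<^sup>2) * (B'\<^sup>2 * (y - 1 / y)) = 0"
      using e2 e4 by algebra
    ultimately have "1 * y + 1 / y = 0 \<and> 1 * y - 1 / y = 0"
      using ne B' by simp
    then show False using sum_nz nz by (metis one_neq_zero)
  qed
  then consider "B' = B" | "B' = - B" by (auto simp: power2_eq_iff)
  then show False
  proof cases
    \<comment> \<open>Equal rates: adding and subtracting the relations compares the coefficients of
      the two exponentials separately. The contradiction is with
      \<open>t\<^sub>1 + t\<^sub>2 \<noteq> 0\<close>.\<close>
    case 1
    have "B * (t\<^sub>2 * x - t\<^sub>1 / x) = y + 1 / y" "B * (t\<^sub>2 * x + t\<^sub>1 / x) = y - 1 / y"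
      "B * (t\<^sub>2 * y - t\<^sub>1 / y) = x + 1 / x" "B * (t\<^sub>2 * y + t\<^sub>1 / y) = x - 1 / x"
      using e1 e2 f1 f2 B unfolding 1 by (simp_all add: power2_eq_square power3_eq_cube)
    then have "B * t\<^sub>2 * x = y" "B * t\<^sub>2 * y = x" "B * (t\<^sub>1 / x) = - 1 / y"
      by algebra+
    then have "B * t\<^sub>2 * x = y" "B * t\<^sub>2 * y = x" "B * t\<^sub>1 * y = - x"
      using nz by (simp_all add: field_simps)
    then have "(t\<^sub>1 + t\<^sub>2) * (B * y) = 0" by (simp add: algebra_simps)
    then show False using t nz B by simp
  next
    \<comment> \<open>Opposite rates: \<open>exp p\<close> is now matched with
      \<open>exp (- q)\<close>, and \<open>B * t\<^sub>1\<close> comes out as both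
      \<open>x * y\<close> and its negative.\<close>
    case 2
    have cancel: "B\<^sup>2 * X = (- B) * Y \<Longrightarrow> B * X = - Y" "B ^ 3 * X = (- B)\<^sup>2 * Y \<Longrightarrow> B * X = Y"
      "(- B)\<^sup>2 * X = B * Y \<Longrightarrow> B * X = Y" "(- B) ^ 3 * X = B\<^sup>2 * Y \<Longrightarrow> B * X = - Y" for X Y
    proof -
      assume "B\<^sup>2 * X = (- B) * Y"
      then have "B * (B * X + Y) = 0" by (simp add: power2_eq_square distrib_left mult.assoc)
      then show "B * X = - Y" using B by (simp add: eq_neg_iff_add_eq_0)
    next
      assume "B ^ 3 * X = (- B)\<^sup>2 * Y"
      then show "B * X = Y" using B by (simp add: power2_eq_square power3_eq_cube)
    next
      assume "(- B)\<^sup>2 * X = B * Y"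
      then show "B * X = Y" using B by (simp add: power2_eq_square)
    next
      assume "(- B) ^ 3 * X = B\<^sup>2 * Y"
      from arg_cong[OF this, of uminus] have "B\<^sup>2 * (B * X) = B\<^sup>2 * (- Y)"
        by (simp add: power2_eq_square power3_eq_cube mult.assoc)
      then show "B * X = - Y" by (rule mult_left_cancel[OF power_not_zero[OF B], THEN iffD1])
    qed
    have "B * (t\<^sub>2 * x - t\<^sub>1 / x) = - (y + 1 / y)" "B * (t\<^sub>2 * x + t\<^sub>1 / x) = y - 1 / y"
      "B * (t\<^sub>2 * y - t\<^sub>1 / y) = x + 1 / x" "B * (t\<^sub>2 * y + t\<^sub>1 / y) = - (x - 1 / x)"
      using cancel e1 e2 f1 f2 unfolding 2 by blast+
    then have "B * (t\<^sub>1 / x) = y" "B * (t\<^sub>1 / y) = - x"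
      by algebra+
    then have "B * t\<^sub>1 = x * y" "B * t\<^sub>1 = - (x * y)"
      using nz by (simp_all add: field_simps)
    then show False using nz by simp
  qed
qed

text \<open>The derivative bound at maxima makes the real parts of \<open>p\<close> and
  \<open>q\<close> grow at most linearly, which reduces the system to the affine case.\<close>

lemma exp_system_trivial:
  fixes p q p' q' :: "complex \<Rightarrow> complex"
  assumes p: "\<And>z. (p has_field_derivative p' z) (at z)"
    and q: "\<And>z. (q has_field_derivative q' z) (at z)"
    and eq1: "\<And>z. p' z * (t\<^sub>2 * exp (p z) + t\<^sub>1 * exp (- p z)) = \<eta> + exp (q z) - exp (- q z)"
    and eq2: "\<And>z. q' z * (t\<^sub>2 * exp (q z) + t\<^sub>1 * exp (- q z)) = \<eta> + exp (p z) - exp (- p z)"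
    and t: "t\<^sub>1 \<noteq> 0" "t\<^sub>2 \<noteq> 0" "t\<^sub>1 + t\<^sub>2 \<noteq> 0"
  shows "p' z = 0"
proof -
  obtain K\<^sub>1 S\<^sub>1 where K1: "0 \<le> K\<^sub>1"
    "\<And>w P Q. w * (t\<^sub>2 * exp P + t\<^sub>1 * exp (- P)) = \<eta> + exp Q - exp (- Q) \<Longrightarrow>
       S\<^sub>1 \<le> Re P \<Longrightarrow> \<bar>Re Q\<bar> \<le> Re P \<Longrightarrow> norm w \<le> K\<^sub>1"
    using exp_quotient_bounded t by metis
  \<comment> \<open>This version serves \<open>- p\<close> and \<open>- q\<close>: negating both
    functions exchanges \<open>t\<^sub>1\<close> with \<open>t\<^sub>2\<close> and flips the sign of
    \<open>\<eta>\<close>.\<close>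
  obtain K\<^sub>2 S\<^sub>2 where K2: "0 \<le> K\<^sub>2"
    "\<And>w P Q. w * (t\<^sub>1 * exp P + t\<^sub>2 * exp (- P)) = - \<eta> + exp Q - exp (- Q) \<Longrightarrow>
       S\<^sub>2 \<le> Re P \<Longrightarrow> \<bar>Re Q\<bar> \<le> Re P \<Longrightarrow> norm w \<le> K\<^sub>2"
    using exp_quotient_bounded t by metis
  \<comment> \<open>Functions are paired with their derivatives. Closure under negation makes the
    largest real part dominate both \<open>\<bar>Re (p z)\<bar>\<close> and
    \<open>\<bar>Re (q z)\<bar>\<close>.\<close>
  define I where "I = {(p, p'), (\<lambda>z. - p z, \<lambda>z. - p' z), (q, q'), (\<lambda>z. - q z, \<lambda>z. - q' z)}"
  have mem: "(p, p') \<in> I" "(\<lambda>z. - p z, \<lambda>z. - p' z) \<in> I" "(q, q') \<in> I"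
    "(\<lambda>z. - q z, \<lambda>z. - q' z) \<in> I"
    by (simp_all add: I_def)
  obtain c where c: "\<And>i z. i \<in> I \<Longrightarrow> Re (fst i z) \<le> (max K\<^sub>1 K\<^sub>2 + 1) * norm z + c"
  proof (rule Re_le_linear_if_deriv_bounded_at_max[of I "max K\<^sub>1 K\<^sub>2" fst snd "max S\<^sub>1 S\<^sub>2"])
    show "(fst i has_field_derivative snd i z) (at z)" if "i \<in> I" for i z
      using that by (auto simp: I_def intro!: derivative_eq_intros p q)
    show "norm (snd i z) \<le> max K\<^sub>1 K\<^sub>2"
      if i: "i \<in> I" and S: "max S\<^sub>1 S\<^sub>2 \<le> Re (fst i z)"
        and max: "\<forall>j\<in>I. Re (fst j z) \<le> Re (fst i z)" for i z
    proof -
      have le: "\<bar>Re (p z)\<bar> \<le> Re (fst i z)" "\<bar>Re (q z)\<bar> \<le> Re (fst i z)"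
        using mem[THEN max[rule_format]] by auto
      consider "i = (p, p')" | "i = (\<lambda>z. - p z, \<lambda>z. - p' z)" | "i = (q, q')"
        | "i = (\<lambda>z. - q z, \<lambda>z. - q' z)"
        using i by (auto simp: I_def)
      then show ?thesis
      proof cases
        case 1
        with K1(2)[OF eq1, of z] S le show ?thesis by simp
      next
        case 2
        with K2(2)[of "- p' z" "- p z" "- q z"] eq1[of z] S le show ?thesis
          by (simp add: algebra_simps)
      next
        case 3
        with K1(2)[OF eq2, of z] S le show ?thesis by simp
      next
        case 4
        with K2(2)[of "- q' z" "- q z" "- p z"] eq2[of z] S le show ?thesis
          by (simp add: algebra_simps)
      qed
    qed
  qed (use K1(1) in \<open>auto simp: I_def\<close>)
  have "p holomorphic_on UNIV" "q holomorphic_on UNIV"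
    using p q by (auto simp: holomorphic_on_open)
  then obtain A B A' B' where AB: "\<And>z. p z = A + B * z" "\<And>z. q z = A' + B' * z"
    using c[OF mem(1)] c[OF mem(3)] by (metis entire_affine_if_Re_le fst_conv)
  have pq': "p' z = B" "q' z = B'" for z
  proof -
    have "(p has_field_derivative B) (at z)" "(q has_field_derivative B') (at z)"
      unfolding AB[abs_def] by (auto intro!: derivative_eq_intros)
    then show "p' z = B" "q' z = B'"
      using p q DERIV_unique by blast+
  qed
  have "B = 0"
    using affine_exp_system_trivial[of B t\<^sub>2 A t\<^sub>1 \<eta> A' B'] eq1 eq2 t unfolding AB pq' by blast
  then show ?thesis by (simp add: pq')
qed

section \<open>The conic as a hyperbola and its entire parametrization\<close>

text \<open>Moving the origin to the center of the conic removes the linear terms, and the remaining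
  quadratic form splits into two linear factors. The conditions on the coefficients say that the
  conic is nondegenerate with distinct asymptotes, and \<open>\<alpha> \<noteq> 0\<close> gives
  \<open>t\<^sub>1 + t\<^sub>2 \<noteq> 0\<close>.\<close>

lemma conic_hyperbola_form:
  fixes a b C \<alpha> \<beta> \<gamma> :: complex
  assumes "a * b \<noteq> 0" "\<alpha>\<^sup>2 \<noteq> 0" "\<alpha>\<^sup>2 \<noteq> a * b"
    and "a * b * C + 2 * \<alpha> * \<beta> * \<gamma> - a * \<gamma>\<^sup>2 - b * \<beta>\<^sup>2 - C * \<alpha>\<^sup>2 \<noteq> 0"
  obtains t\<^sub>1 t\<^sub>2 x\<^sub>0 y\<^sub>0 \<kappa> where "t\<^sub>1 \<noteq> 0" "t\<^sub>2 \<noteq> 0" "t\<^sub>1 + t\<^sub>2 \<noteq> 0" "t\<^sub>1 \<noteq> t\<^sub>2" "\<kappa> \<noteq> 0"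
    "\<And>X Y. a * X\<^sup>2 + 2 * \<alpha> * X * Y + b * Y\<^sup>2 + 2 * \<beta> * X + 2 * \<gamma> * Y + C = 0 \<Longrightarrow>
       (X - x\<^sub>0 - t\<^sub>1 * (Y - y\<^sub>0)) * (X - x\<^sub>0 - t\<^sub>2 * (Y - y\<^sub>0)) = \<kappa>"
proof -
  define D where "D = \<alpha>\<^sup>2 - a * b"
  define d where "d = csqrt D"
  have d: "d\<^sup>2 = \<alpha>\<^sup>2 - a * b" by (simp add: d_def D_def)
  have nz: "a \<noteq> 0" "b \<noteq> 0" "\<alpha> \<noteq> 0" "D \<noteq> 0" "d \<noteq> 0"
    using assms d by (auto simp: D_def)
  \<comment> \<open>These are the roots of \<open>a * t\<^sup>2 + 2 * \<alpha> * t + b\<close>. The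
    center \<open>(x\<^sub>0, y\<^sub>0)\<close>, where both partial derivatives of the conic
    polynomial vanish, comes from Cramer's rule, and \<open>- a * \<kappa>\<close> is the value of
    that polynomial at the center.\<close>
  define t\<^sub>1 t\<^sub>2 where "t\<^sub>1 = (d - \<alpha>) / a" and "t\<^sub>2 = (- d - \<alpha>) / a"
  define x\<^sub>0 y\<^sub>0 where "x\<^sub>0 = (b * \<beta> - \<alpha> * \<gamma>) / D" and "y\<^sub>0 = (a * \<gamma> - \<alpha> * \<beta>) / D"
  define \<kappa> where "\<kappa> = - (\<beta> * x\<^sub>0 + \<gamma> * y\<^sub>0 + C) / a"
  have at: "a * t\<^sub>1 = d - \<alpha>" "a * t\<^sub>2 = - d - \<alpha>"
    using nz by (simp_all add: t\<^sub>1_def t\<^sub>2_def)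
  have "(a * t\<^sub>1) * (a * t\<^sub>2) = a * b"
    unfolding at using d by (simp add: algebra_simps power2_eq_square)
  then have prod: "a * (t\<^sub>1 * t\<^sub>2) = b"
    using nz by (simp add: mult.left_commute mult.assoc)
  have sum: "a * (t\<^sub>1 + t\<^sub>2) = - 2 * \<alpha>" unfolding distrib_left at by simp
  have x0D: "x\<^sub>0 * D = b * \<beta> - \<alpha> * \<gamma>" and y0D: "y\<^sub>0 * D = a * \<gamma> - \<alpha> * \<beta>"
    using nz by (simp_all add: x\<^sub>0_def y\<^sub>0_def)
  have "D * (a * x\<^sub>0 + \<alpha> * y\<^sub>0 + \<beta>) = a * (x\<^sub>0 * D) + \<alpha> * (y\<^sub>0 * D) + \<beta> * D"
    "D * (\<alpha> * x\<^sub>0 + b * y\<^sub>0 + \<gamma>) = \<alpha> * (x\<^sub>0 * D) + b * (y\<^sub>0 * D) + \<gamma> * D"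
    by (simp_all add: algebra_simps)
  then have "D * (a * x\<^sub>0 + \<alpha> * y\<^sub>0 + \<beta>) = 0" "D * (\<alpha> * x\<^sub>0 + b * y\<^sub>0 + \<gamma>) = 0"
    unfolding x0D y0D by (simp_all add: D_def algebra_simps power2_eq_square)
  then have center: "a * x\<^sub>0 + \<alpha> * y\<^sub>0 + \<beta> = 0" "\<alpha> * x\<^sub>0 + b * y\<^sub>0 + \<gamma> = 0"
    using nz by simp_all
  have ak: "a * \<kappa> = - (\<beta> * x\<^sub>0 + \<gamma> * y\<^sub>0 + C)"
    using nz by (simp add: \<kappa>_def)
  show thesis
  proof (rule that)
    show "t\<^sub>1 \<noteq> 0" "t\<^sub>2 \<noteq> 0" "t\<^sub>1 + t\<^sub>2 \<noteq> 0"
      using prod sum nz by auto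
    show "t\<^sub>1 \<noteq> t\<^sub>2"
    proof
      assume "t\<^sub>1 = t\<^sub>2"
      then have "d - \<alpha> = - d - \<alpha>" using at by simp
      then show False using nz by simp
    qed
    show "\<kappa> \<noteq> 0"
    proof
      assume "\<kappa> = 0"
      \<comment> \<open>Clearing the denominator \<open>D\<close> turns the value at the center into
        minus the determinant of the conic.\<close>
      then have "0 = D * (\<beta> * x\<^sub>0 + \<gamma> * y\<^sub>0 + C)" using ak \<open>\<kappa> = 0\<close> by (metis mult_zero_right neg_equal_0_iff_equal)
      also have "\<dots> = \<beta> * (x\<^sub>0 * D) + \<gamma> * (y\<^sub>0 * D) + C * D"
        by (simp add: algebra_simps)
      also have "\<dots> = - (a * b * C + 2 * \<alpha> * \<beta> * \<gamma> - a * \<gamma>\<^sup>2 - b * \<beta>\<^sup>2 - C * \<alpha>\<^sup>2)"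
        unfolding x0D y0D unfolding D_def by (simp add: algebra_simps power2_eq_square)
      finally show False using assms(4) by simp
    qed
    fix X Y
    assume Q: "a * X\<^sup>2 + 2 * \<alpha> * X * Y + b * Y\<^sup>2 + 2 * \<beta> * X + 2 * \<gamma> * Y + C = 0"
    define u v where "u = X - x\<^sub>0" and "v = Y - y\<^sub>0"
    have XY: "X = u + x\<^sub>0" "Y = v + y\<^sub>0" by (simp_all add: u_def v_def)
    have "a * ((u - t\<^sub>1 * v) * (u - t\<^sub>2 * v))
        = a * u\<^sup>2 - (a * (t\<^sub>1 + t\<^sub>2)) * u * v + (a * (t\<^sub>1 * t\<^sub>2)) * v\<^sup>2"
      by (simp add: algebra_simps power2_eq_square)
    also have "\<dots> = a * u\<^sup>2 + 2 * \<alpha> * u * v + b * v\<^sup>2"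
      unfolding prod sum by simp
    also have "\<dots> = (a * X\<^sup>2 + 2 * \<alpha> * X * Y + b * Y\<^sup>2 + 2 * \<beta> * X + 2 * \<gamma> * Y + C)
        - (2 * u + x\<^sub>0) * (a * x\<^sub>0 + \<alpha> * y\<^sub>0 + \<beta>) - (2 * v + y\<^sub>0) * (\<alpha> * x\<^sub>0 + b * y\<^sub>0 + \<gamma>)
        - (\<beta> * x\<^sub>0 + \<gamma> * y\<^sub>0 + C)"
      unfolding XY by (simp add: algebra_simps power2_eq_square)
    also have "\<dots> = a * \<kappa>"
      unfolding Q center ak by simp
    finally have "a * ((X - x\<^sub>0 - t\<^sub>1 * (Y - y\<^sub>0)) * (X - x\<^sub>0 - t\<^sub>2 * (Y - y\<^sub>0))) = a * \<kappa>"
      unfolding u_def v_def .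
    then show "(X - x\<^sub>0 - t\<^sub>1 * (Y - y\<^sub>0)) * (X - x\<^sub>0 - t\<^sub>2 * (Y - y\<^sub>0)) = \<kappa>"
      using nz by simp
  qed
qed

text \<open>Since the product is a nonzero constant, \<open>U\<close> has no zeros and
  \<open>U / k\<close> has an entire logarithm. Taking the constant as a square gives both factors
  the same coefficient \<open>k\<close>.\<close>

lemma entire_hyperbola_param:
  assumes "U holomorphic_on UNIV" and UV: "\<And>z. U z * V z = k\<^sup>2" and k: "k \<noteq> 0"
  obtains p p' where "\<And>z. (p has_field_derivative p' z) (at z)"
    "\<And>z. U z = k * exp (p z)" "\<And>z. V z = k * exp (- p z)"
proof -
  have U0: "U z \<noteq> 0" for z using UV[of z] k by auto
  have "(\<lambda>z. U z / k) holomorphic_on UNIV"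
    using assms(1) k by (auto intro!: holomorphic_intros)
  then obtain p where p: "p holomorphic_on UNIV" "\<And>z. exp (p z) = U z / k"
    by (rule holomorphic_logarithm_exists[of UNIV "\<lambda>z. U z / k" 0, OF convex_UNIV open_UNIV])
      (use k U0 in auto)
  have "(p has_field_derivative deriv p z) (at z)" for z
    using p(1) holomorphic_derivI by blast
  moreover have U_eq: "U z = k * exp (p z)" for z using p(2)[of z] k by simp
  moreover have "V z = k * exp (- p z)" for z
  proof -
    have "k * (V z * exp (p z)) = k * k"
      using UV[of z] by (simp add: U_eq power2_eq_square mult_ac)
    then show ?thesis using k by (simp add: exp_minus field_simps)
  qed
  ultimately show thesis using that by blast
qed

text \<open>The first equation expresses \<open>F\<close> and \<open>G'\<close> through
  \<open>exp p\<close>, the second expresses \<open>G\<close> and \<open>F'\<close> through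
  \<open>exp q\<close>. Differentiating the formulas for \<open>F\<close> and \<open>G\<close> and
  comparing yields the system of \<open>exp_system_trivial\<close>.\<close>

lemma entire_hyperbola_system_deriv_0:
  fixes F G F' G' :: "complex \<Rightarrow> complex"
  assumes F: "\<And>z. (F has_field_derivative F' z) (at z)"
    and G: "\<And>z. (G has_field_derivative G' z) (at z)"
    and eq1: "\<And>z. (F z - x\<^sub>0 - t\<^sub>1 * (G' z - y\<^sub>0)) * (F z - x\<^sub>0 - t\<^sub>2 * (G' z - y\<^sub>0)) = \<kappa>"
    and eq2: "\<And>z. (G z - x\<^sub>0 - t\<^sub>1 * (F' z - y\<^sub>0)) * (G z - x\<^sub>0 - t\<^sub>2 * (F' z - y\<^sub>0)) = \<kappa>"
    and t: "t\<^sub>1 \<noteq> 0" "t\<^sub>2 \<noteq> 0" "t\<^sub>1 + t\<^sub>2 \<noteq> 0" "t\<^sub>1 \<noteq> t\<^sub>2" and \<kappa>: "\<kappa> \<noteq> 0"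
  shows "F' z = 0"
proof -
  define k where "k = csqrt \<kappa>"
  have k: "k \<noteq> 0" and k2: "k\<^sup>2 = \<kappa>" using \<kappa> by (auto simp: k_def)
  define \<delta> where "\<delta> = t\<^sub>2 - t\<^sub>1"
  define \<eta> where "\<eta> = y\<^sub>0 * \<delta> / k"
  have \<delta>: "\<delta> \<noteq> 0" using t by (simp add: \<delta>_def)
  have \<eta>: "k * \<eta> = y\<^sub>0 * \<delta>" using k by (simp add: \<eta>_def)
  have holF: "F holomorphic_on UNIV" and holG: "G holomorphic_on UNIV"
    using F G by (auto simp: holomorphic_on_open)
  have "F' = deriv F" "G' = deriv G"
    using F G DERIV_imp_deriv by (metis ext)+
  then have holF': "F' holomorphic_on UNIV" and holG': "G' holomorphic_on UNIV"
    using holF holG by (auto intro: holomorphic_deriv)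
  have "(\<lambda>z. F z - x\<^sub>0 - t\<^sub>1 * (G' z - y\<^sub>0)) holomorphic_on UNIV"
    by (intro holomorphic_intros holF holG')
  then obtain p p' where
    p: "\<And>z. (p has_field_derivative p' z) (at z)"
      "\<And>z. F z - x\<^sub>0 - t\<^sub>1 * (G' z - y\<^sub>0) = k * exp (p z)"
      "\<And>z. F z - x\<^sub>0 - t\<^sub>2 * (G' z - y\<^sub>0) = k * exp (- p z)"
    by (rule entire_hyperbola_param[OF _ eq1[folded k2] k]) (rule that)
  have "(\<lambda>z. G z - x\<^sub>0 - t\<^sub>1 * (F' z - y\<^sub>0)) holomorphic_on UNIV"
    by (intro holomorphic_intros holG holF')
  then obtain q q' where
    q: "\<And>z. (q has_field_derivative q' z) (at z)"
      "\<And>z. G z - x\<^sub>0 - t\<^sub>1 * (F' z - y\<^sub>0) = k * exp (q z)"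
      "\<And>z. G z - x\<^sub>0 - t\<^sub>2 * (F' z - y\<^sub>0) = k * exp (- q z)"
    by (rule entire_hyperbola_param[OF _ eq2[folded k2] k]) (rule that)
  have G': "\<delta> * G' z = k * (\<eta> + exp (p z) - exp (- p z))"
    and F_eq: "\<delta> * F z = \<delta> * x\<^sub>0 + k * (t\<^sub>2 * exp (p z) - t\<^sub>1 * exp (- p z))"
    and F': "\<delta> * F' z = k * (\<eta> + exp (q z) - exp (- q z))"
    and G_eq: "\<delta> * G z = \<delta> * x\<^sub>0 + k * (t\<^sub>2 * exp (q z) - t\<^sub>1 * exp (- q z))" for z
  proof -
    \<comment> \<open>The difference of the two linear factors isolates the derivative, and the
      combination with weights \<open>t\<^sub>2\<close> and \<open>- t\<^sub>1\<close> isolates the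
      function.\<close>
    have "k * exp (p z) - k * exp (- p z) = \<delta> * (G' z - y\<^sub>0)"
      "t\<^sub>2 * (k * exp (p z)) - t\<^sub>1 * (k * exp (- p z)) = \<delta> * (F z - x\<^sub>0)"
      unfolding p(2,3)[symmetric] \<delta>_def by (simp_all add: algebra_simps)
    then show "\<delta> * G' z = k * (\<eta> + exp (p z) - exp (- p z))"
      "\<delta> * F z = \<delta> * x\<^sub>0 + k * (t\<^sub>2 * exp (p z) - t\<^sub>1 * exp (- p z))"
      using \<eta> by (simp_all add: algebra_simps)
    have "k * exp (q z) - k * exp (- q z) = \<delta> * (F' z - y\<^sub>0)"
      "t\<^sub>2 * (k * exp (q z)) - t\<^sub>1 * (k * exp (- q z)) = \<delta> * (G z - x\<^sub>0)"
      unfolding q(2,3)[symmetric] \<delta>_def by (simp_all add: algebra_simps)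
    then show "\<delta> * F' z = k * (\<eta> + exp (q z) - exp (- q z))"
      "\<delta> * G z = \<delta> * x\<^sub>0 + k * (t\<^sub>2 * exp (q z) - t\<^sub>1 * exp (- q z))"
      using \<eta> by (simp_all add: algebra_simps)
  qed
  have dF: "\<delta> * F' z = k * (p' z * (t\<^sub>2 * exp (p z) + t\<^sub>1 * exp (- p z)))"
    and dG: "\<delta> * G' z = k * (q' z * (t\<^sub>2 * exp (q z) + t\<^sub>1 * exp (- q z)))" for z
  proof -
    have "((\<lambda>z. \<delta> * F z) has_field_derivative \<delta> * F' z) (at z)"
      "((\<lambda>z. \<delta> * G z) has_field_derivative \<delta> * G' z) (at z)"
      by (intro DERIV_cmult F G)+
    moreover have "((\<lambda>z. \<delta> * F z) has_field_derivative
        k * (p' z * (t\<^sub>2 * exp (p z) + t\<^sub>1 * exp (- p z)))) (at z)"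
      unfolding F_eq by (auto intro!: derivative_eq_intros p(1) simp: algebra_simps)
    moreover have "((\<lambda>z. \<delta> * G z) has_field_derivative
        k * (q' z * (t\<^sub>2 * exp (q z) + t\<^sub>1 * exp (- q z)))) (at z)"
      unfolding G_eq by (auto intro!: derivative_eq_intros q(1) simp: algebra_simps)
    ultimately show "\<delta> * F' z = k * (p' z * (t\<^sub>2 * exp (p z) + t\<^sub>1 * exp (- p z)))"
      "\<delta> * G' z = k * (q' z * (t\<^sub>2 * exp (q z) + t\<^sub>1 * exp (- q z)))"
      using DERIV_unique by blast+
  qed
  have "p' z = 0" for z
  proof (rule exp_system_trivial[OF p(1) q(1)])
    show "p' z * (t\<^sub>2 * exp (p z) + t\<^sub>1 * exp (- p z)) = \<eta> + exp (q z) - exp (- q z)"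
      "q' z * (t\<^sub>2 * exp (q z) + t\<^sub>1 * exp (- q z)) = \<eta> + exp (p z) - exp (- p z)" for z
      using dF[of z] F'[of z] dG[of z] G'[of z] k by simp_all
  qed (use t in auto)
  then show ?thesis using dF[of z] \<delta> by simp
qed

section \<open>Restriction to complex lines in several variables\<close>

text \<open>Though \<open>partial_deriv\<close> is a derivative at parameter 0, it gives the
  derivative of the restriction to a coordinate line at every parameter \<open>t\<close>. This makes
  the one-variable results applicable on each line.\<close>

lemma entire_has_partial_deriv:
  assumes "entire f"
  shows "((\<lambda>t. f (z + axis i t)) has_field_derivative partial_deriv i f (z + axis i t)) (at t)"
proof -
  obtain D where D: "(f has_derivative D) (at (z + axis i t))" "\<And>c v. D (c *s v) = c * D v"
    using assms unfolding entire_def by blast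
  have lin: "bounded_linear (axis i :: complex \<Rightarrow> complex ^ 'a)"
    by (intro linear_conv_bounded_linear[THEN iffD1] linearI) (auto simp: vec_eq_iff axis_def)
  have "((\<lambda>t. z + axis i t) has_derivative axis i) (at t)"
    using bounded_linear_imp_has_derivative[OF lin] by (auto intro!: derivative_eq_intros)
  from has_derivative_compose[OF this D(1)]
  have "((\<lambda>t. f (z + axis i t)) has_derivative (\<lambda>t. D (axis i t))) (at t)" .
  \<comment> \<open>Complex linearity of the differential upgrades the real derivative along the
    line to a complex one.\<close>
  moreover have "(\<lambda>s. D (axis i s)) = (*) (D (axis i 1))"
  proof
    fix s
    have "axis i s = s *s axis i (1 :: complex)"
      by (simp add: vec_eq_iff axis_def)
    then show "D (axis i s) = D (axis i 1) * s" by (metis D(2) mult.commute)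
  qed
  ultimately have der: "((\<lambda>t. f (z + axis i t)) has_field_derivative D (axis i 1)) (at t)"
    unfolding has_field_derivative_def by (simp only:)
  then have "((\<lambda>s. f (z + axis i (t + s))) has_field_derivative D (axis i 1)) (at 0)"
    using DERIV_shift[of "\<lambda>t. f (z + axis i t)" "D (axis i 1)" 0 t] by (simp add: add.commute)
  then have "partial_deriv i f (z + axis i t) = D (axis i 1)"
    unfolding partial_deriv_def
    by (intro DERIV_imp_deriv) (simp add: linear_add[OF bounded_linear.linear[OF lin]] algebra_simps)
  with der show ?thesis by simp
qed

lemma entire_imp_continuous:
  assumes "entire f"
  shows "continuous_on UNIV f"
proof (rule continuous_at_imp_continuous_on, rule ballI)
  fix z
  obtain D where "(f has_derivative D) (at z)"
    using assms unfolding entire_def by blast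
  then show "isCont f z" by (rule has_derivative_continuous)
qed

lemma polynomial_fun_const: "polynomial_fun (\<lambda>z. c)"
  unfolding polynomial_fun_def
  by (intro exI[of _ "{\<lambda>_. 0}"] exI[of _ "\<lambda>_. c"]) simp

text \<open>The range is connected and lies in the finite root set of a nonzero polynomial, so the
  function is constant.\<close>

lemma polynomial_fun_if_quadratic_root:
  fixes f :: "complex ^ 'n::finite \<Rightarrow> complex"
  assumes "entire f" "a \<noteq> 0" and root: "\<And>z. a * (f z)\<^sup>2 + b * f z + c = 0"
  shows "polynomial_fun f"
proof -
  have "range f \<subseteq> {x. poly [:c, b, a:] x = 0}"
    using root by (auto simp: power2_eq_square algebra_simps)
  moreover have "finite {x. poly [:c, b, a:] x = 0}"
    using \<open>a \<noteq> 0\<close> by (intro poly_roots_finite) simp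
  ultimately have "finite (range f)" by (rule finite_subset)
  moreover have "connected (range f)"
    using entire_imp_continuous[OF \<open>entire f\<close>] by (intro connected_continuous_image) auto
  ultimately obtain x where "range f = {x}"
    by (metis connected_finite_iff_sing image_is_empty UNIV_not_empty)
  then have "f = (\<lambda>_. x)" by auto
  then show ?thesis by (simp add: polynomial_fun_const)
qed

section \<open>Nonexistence of transcendental solution pairs\<close>

theorem theorem3p2:
  fixes a b C \<alpha> \<beta> \<gamma> :: complex and i1 :: "'n::finite"
  assumes "CARD('n) \<ge> 2"
    and "a * b \<noteq> 0"
    and "a * b * C + 2 * \<alpha> * \<beta> * \<gamma> - a * \<gamma>\<^sup>2 - b * \<beta>\<^sup>2 - C * \<alpha>\<^sup>2 \<noteq> 0"
    and "\<alpha>\<^sup>2 \<noteq> 0"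
    and "\<alpha>\<^sup>2 \<noteq> a * b"
  shows "\<not> (\<exists>f1 f2 :: complex ^ 'n \<Rightarrow> complex.
      transcendental_entire f1 \<and> finite_order f1 \<and>
      transcendental_entire f2 \<and> finite_order f2 \<and>
      (\<forall>z. a * (f1 z)\<^sup>2 + 2 * \<alpha> * f1 z * partial_deriv i1 f2 z + b * (partial_deriv i1 f2 z)\<^sup>2
            + 2 * \<beta> * f1 z + 2 * \<gamma> * partial_deriv i1 f2 z + C = 0) \<and>
      (\<forall>z. a * (f2 z)\<^sup>2 + 2 * \<alpha> * f2 z * partial_deriv i1 f1 z + b * (partial_deriv i1 f1 z)\<^sup>2
            + 2 * \<beta> * f2 z + 2 * \<gamma> * partial_deriv i1 f1 z + C = 0))"
proof (rule notI, elim exE conjE)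
  fix f1 f2 :: "complex ^ 'n \<Rightarrow> complex"
  assume "transcendental_entire f1" "transcendental_entire f2"
  then have ent: "entire f1" "entire f2" and npoly: "\<not> polynomial_fun f2"
    by (simp_all add: transcendental_entire_def)
  assume "\<forall>z. a * (f1 z)\<^sup>2 + 2 * \<alpha> * f1 z * partial_deriv i1 f2 z + b * (partial_deriv i1 f2 z)\<^sup>2
            + 2 * \<beta> * f1 z + 2 * \<gamma> * partial_deriv i1 f2 z + C = 0"
  note eq1 = this[rule_format]
  assume "\<forall>z. a * (f2 z)\<^sup>2 + 2 * \<alpha> * f2 z * partial_deriv i1 f1 z + b * (partial_deriv i1 f1 z)\<^sup>2
            + 2 * \<beta> * f2 z + 2 * \<gamma> * partial_deriv i1 f1 z + C = 0"
  note eq2 = this[rule_format]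
  obtain t\<^sub>1 t\<^sub>2 x\<^sub>0 y\<^sub>0 \<kappa> where t: "t\<^sub>1 \<noteq> 0" "t\<^sub>2 \<noteq> 0" "t\<^sub>1 + t\<^sub>2 \<noteq> 0" "t\<^sub>1 \<noteq> t\<^sub>2" "\<kappa> \<noteq> 0"
    and conic: "\<And>X Y. a * X\<^sup>2 + 2 * \<alpha> * X * Y + b * Y\<^sup>2 + 2 * \<beta> * X + 2 * \<gamma> * Y + C = 0 \<Longrightarrow>
       (X - x\<^sub>0 - t\<^sub>1 * (Y - y\<^sub>0)) * (X - x\<^sub>0 - t\<^sub>2 * (Y - y\<^sub>0)) = \<kappa>"
    using conic_hyperbola_form[OF assms(2,4,5,3)] by metis
  \<comment> \<open>The one-variable result is applied on the line through \<open>z\<close> in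
    direction \<open>i1\<close>, at parameter 0.\<close>
  have "partial_deriv i1 f1 (z + axis i1 0) = 0" for z
    by (rule entire_hyperbola_system_deriv_0[OF entire_has_partial_deriv[OF ent(1)]
        entire_has_partial_deriv[OF ent(2)] conic[OF eq1] conic[OF eq2] t])
  then have "partial_deriv i1 f1 z = 0" for z
    by (simp add: axis_def zero_vec_def[symmetric])
  \<comment> \<open>All terms of the second equation that contain the derivative drop out, leaving a
    quadratic with constant coefficients.\<close>
  with eq2 have "a * (f2 z)\<^sup>2 + (2 * \<beta>) * f2 z + C = 0" for z
    by (metis add.right_neutral mult_zero_right power_zero_numeral)
  then have "polynomial_fun f2"
    using polynomial_fun_if_quadratic_root ent(2) assms(2) by (metis mult_zero_left)
  with npoly show False ..
qed

end
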